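(* Let $(G,\circ)$ be a unimodular network with no leaves almost surely and $\mathbf{E}[\deg(\circ)]<\infty$. For every integer $r\ge1$ let $NBW_r(G,\circ)$ be the set of non-backtracking walks of length $r$ in $G$ starting from the root $\circ$. Then $$\mathbf{E}\big[|NBW_r(G,\circ)|\big]\ \ge\ \mathbf{E}[\deg(\circ)]\,\big(\mathbf{E}[\deg(\circ)]-1\big)^{r-1}.$$
   Context: Graphs are simple and undirected. A rooted graph $(G,x)$ is a connected, locally finite graph $G$ with countably many vertices and a distinguished vertex $x$. $\mathcal{G}^*$ is the set of isomorphism classes of rooted graphs, with the Polish topology of local convergence: $(G_n,x_n)\to(G,x)$ iff for every $r$ the $r$-neighbourhoods of the roots are isomorphic as rooted graphs for all large $n$. A random rooted graph is a $\mathcal{G}^*$-valued random variable $(G,\circ)$. It is a unimodular network if $$\mathbf{E}\Big[\sum_{x\in V(G)}f(G,\circ,x)\Big]=\mathbf{E}\Big[\sum_{x\in V(G)}f(G,x,\circ)\Big]$$ for every non-negative measurable function $f$ on the space of isomorphism classes of doubly rooted graphs $(G,x,y)$. "No leaves" means that every vertex has degree at least $2$. A non-backtracking walk of length $r$ is a sequence of vertices $w_0,\dots,w_r$ with $w_{i-1}\sim w_i$ for $1\le i\le r$ and $w_{i+1}\ne w_{i-1}$ for $1\le i\le r-1$. *)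

theory Defs
  imports "HOL-Probability.Probability"
begin

section \<open>Graphs and rooted isomorphism\<close>

text \<open>
  A graph is a pair of a vertex set and a symmetric, irreflexive adjacency relation. Every
  graph considered here has countably many vertices, so up to isomorphism its vertex set
  is a set of natural numbers.
\<close>

type_synonym graph = "nat set \<times> (nat \<times> nat) set"

abbreviation verts :: "graph \<Rightarrow> nat set" where "verts G \<equiv> fst G"
abbreviation adj :: "graph \<Rightarrow> (nat \<times> nat) set" where "adj G \<equiv> snd G"

definition simple_graph :: "graph \<Rightarrow> bool" where
  "simple_graph G \<longleftrightarrow> adj G \<subseteq> verts G \<times> verts G \<and> sym (adj G) \<and> irrefl (adj G)"

definition connected_graph :: "graph \<Rightarrow> bool" where
  "connected_graph G \<longleftrightarrow> (\<forall>u\<in>verts G. \<forall>v\<in>verts G. (u, v) \<in> (adj G)\<^sup>*)"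

definition locally_finite :: "graph \<Rightarrow> bool" where
  "locally_finite G \<longleftrightarrow> (\<forall>v\<in>verts G. finite (adj G `` {v}))"

definition vertex_degree :: "graph \<Rightarrow> nat \<Rightarrow> nat" where
  "vertex_degree G v = card (adj G `` {v})"

text \<open>
  Graphs carry a list of distinguished vertices: one for rooted graphs, two for doubly rooted
  graphs. Isomorphisms have to map the distinguished vertices to each other, in order.
\<close>

definition valid_marked :: "graph \<times> nat list \<Rightarrow> bool" where
  "valid_marked = (\<lambda>(G, xs). simple_graph G \<and> connected_graph G \<and> locally_finite G
     \<and> set xs \<subseteq> verts G)"

definition marked_iso :: "graph \<times> nat list \<Rightarrow> graph \<times> nat list \<Rightarrow> bool" where
  "marked_iso = (\<lambda>(G, xs) (H, ys). \<exists>\<phi>. bij_betw \<phi> (verts G) (verts H)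
     \<and> (\<forall>u\<in>verts G. \<forall>v\<in>verts G. (u, v) \<in> adj G \<longleftrightarrow> (\<phi> u, \<phi> v) \<in> adj H)
     \<and> map \<phi> xs = ys)"

text \<open>
  The subgraph induced by the vertices at distance at most \<open>r\<close> from a distinguished vertex. For
  two distinguished vertices this is the union of the two balls, which may be disconnected for
  small \<open>r\<close>; the topology only depends on large \<open>r\<close>.
\<close>

definition nbhd_verts :: "nat \<Rightarrow> graph \<times> nat list \<Rightarrow> nat set" where
  "nbhd_verts r = (\<lambda>(G, xs). {v. \<exists>x\<in>set xs. \<exists>n\<le>r. (x, v) \<in> adj G ^^ n})"

definition nbhd :: "nat \<Rightarrow> graph \<times> nat list \<Rightarrow> graph \<times> nat list" where
  "nbhd r A = ((nbhd_verts r A, adj (fst A) \<inter> nbhd_verts r A \<times> nbhd_verts r A), snd A)"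

lemma marked_iso_refl: "marked_iso A A"
  by (auto simp: marked_iso_def split: prod.splits intro!: exI[of _ id])

lemma marked_iso_trans:
  assumes "marked_iso A B" "marked_iso B C"
  shows "marked_iso A C"
proof -
  obtain G xs H ys K zs where [simp]: "A = (G, xs)" "B = (H, ys)" "C = (K, zs)"
    by (metis surj_pair)
  from assms obtain \<phi> \<psi> where *:
    "bij_betw \<phi> (verts G) (verts H)"
    "\<And>u v. u \<in> verts G \<Longrightarrow> v \<in> verts G \<Longrightarrow> (u, v) \<in> adj G \<longleftrightarrow> (\<phi> u, \<phi> v) \<in> adj H"
    "map \<phi> xs = ys"
    "bij_betw \<psi> (verts H) (verts K)"
    "\<And>u v. u \<in> verts H \<Longrightarrow> v \<in> verts H \<Longrightarrow> (u, v) \<in> adj H \<longleftrightarrow> (\<psi> u, \<psi> v) \<in> adj K"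
    "map \<psi> ys = zs"
    by (auto simp: marked_iso_def)
  show ?thesis
    unfolding marked_iso_def
    using * bij_betw_apply[OF *(1)]
    by (auto intro!: exI[of _ "\<psi> \<circ> \<phi>"] bij_betw_trans[of \<phi> _ "verts H"])
qed

lemma marked_iso_sym:
  assumes "marked_iso A B" "set (snd A) \<subseteq> verts (fst A)"
  shows "marked_iso B A"
proof -
  obtain G xs H ys where [simp]: "A = (G, xs)" "B = (H, ys)"
    by (metis surj_pair)
  from assms obtain \<phi> where *:
    "bij_betw \<phi> (verts G) (verts H)"
    "\<And>u v. u \<in> verts G \<Longrightarrow> v \<in> verts G \<Longrightarrow> (u, v) \<in> adj G \<longleftrightarrow> (\<phi> u, \<phi> v) \<in> adj H"
    "map \<phi> xs = ys"
    by (auto simp: marked_iso_def)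
  let ?\<psi> = "inv_into (verts G) \<phi>"
  have b: "bij_betw ?\<psi> (verts H) (verts G)"
    using *(1) by (rule bij_betw_inv_into)
  have "map ?\<psi> ys = xs"
    unfolding *(3)[symmetric] using assms(2) *(1)
    by (auto intro!: map_idI simp: bij_betw_inv_into_left subset_iff)
  moreover have "(u, v) \<in> adj H \<longleftrightarrow> (?\<psi> u, ?\<psi> v) \<in> adj G" if "u \<in> verts H" "v \<in> verts H" for u v
    using *(2)[of "?\<psi> u" "?\<psi> v"] bij_betw_apply[OF b] that
    by (simp add: bij_betw_inv_into_right[OF *(1)])
  ultimately show ?thesis
    using b by (auto simp: marked_iso_def)
qed

lemma roots_in_nbhd: "set (snd A) \<subseteq> nbhd_verts r A"
  by (force simp: nbhd_verts_def intro: exI[of _ 0] split: prod.splits)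

lemma relpow_subset_closed:
  assumes "E \<subseteq> V \<times> V" "(x, v) \<in> E ^^ n" "x \<in> V"
  shows "v \<in> V"
  using assms(2) by (cases n) (use assms in auto)

lemma nbhd_verts_subset:
  assumes "adj G \<subseteq> verts G \<times> verts G" "set xs \<subseteq> verts G"
  shows "nbhd_verts r (G, xs) \<subseteq> verts G"
  using assms relpow_subset_closed[OF assms(1)] by (auto simp: nbhd_verts_def)

lemma nbhd_nbhd:
  assumes "s \<le> r"
  shows "nbhd s (nbhd r A) = nbhd s A"
proof -
  obtain G xs where A [simp]: "A = (G, xs)"
    by (metis surj_pair)
  define F where "F = adj G \<inter> nbhd_verts r A \<times> nbhd_verts r A"
  have F1: "F \<subseteq> adj G"
    by (auto simp: F_def)
  have step: "(x, v) \<in> F ^^ n" if "(x, v) \<in> adj G ^^ n" "n \<le> r" "x \<in> set xs" for x v n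
    using that
  proof (induction n arbitrary: v)
    case (Suc n)
    from Suc.prems obtain u where u: "(x, u) \<in> adj G ^^ n" "(u, v) \<in> adj G"
      by auto
    have "u \<in> nbhd_verts r A"
      unfolding nbhd_verts_def A using Suc.prems(2,3) u(1) Suc_leD by blast
    moreover have "v \<in> nbhd_verts r A"
      unfolding nbhd_verts_def A using Suc.prems by blast
    ultimately have "(u, v) \<in> F"
      using u by (auto simp: F_def)
    with Suc u show ?case by auto
  qed auto
  have "(x, v) \<in> adj G ^^ n" if "(x, v) \<in> F ^^ n" for x v n
    using that
  proof (induction n arbitrary: v)
    case (Suc n)
    then obtain u where "(x, u) \<in> F ^^ n" "(u, v) \<in> F"
      by auto
    with Suc.IH F1 show ?case by auto
  qed auto
  then have "(x, v) \<in> F ^^ n \<longleftrightarrow> (x, v) \<in> adj G ^^ n" if "n \<le> s" "x \<in> set xs" for x v n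
    using step[of x v n] that assms by (meson order_trans)
  then have V: "nbhd_verts s ((nbhd_verts r A, F), xs) = nbhd_verts s A"
    unfolding nbhd_verts_def A prod.case snd_conv by blast
  have sub: "nbhd_verts s A \<subseteq> nbhd_verts r A"
    unfolding nbhd_verts_def A prod.case using assms order_trans by blast
  have nr: "nbhd r A = ((nbhd_verts r A, F), xs)"
    by (simp add: nbhd_def F_def)
  have "F \<inter> nbhd_verts s A \<times> nbhd_verts s A = adj G \<inter> nbhd_verts s A \<times> nbhd_verts s A"
    using sub unfolding F_def by blast
  then show ?thesis
    unfolding nr by (simp add: nbhd_def V del: A) (simp add: A)
qed

lemma marked_iso_nbhd:
  assumes "marked_iso A B"
    and "adj (fst A) \<subseteq> verts (fst A) \<times> verts (fst A)" "set (snd A) \<subseteq> verts (fst A)"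
    and "adj (fst B) \<subseteq> verts (fst B) \<times> verts (fst B)"
  shows "marked_iso (nbhd r A) (nbhd r B)"
proof -
  obtain G xs H ys where AB [simp]: "A = (G, xs)" "B = (H, ys)"
    by (metis surj_pair)
  from assms obtain \<phi> where *:
    "bij_betw \<phi> (verts G) (verts H)"
    "\<And>u v. u \<in> verts G \<Longrightarrow> v \<in> verts G \<Longrightarrow> (u, v) \<in> adj G \<longleftrightarrow> (\<phi> u, \<phi> v) \<in> adj H"
    "map \<phi> xs = ys"
    by (auto simp: marked_iso_def)
  have G: "adj G \<subseteq> verts G \<times> verts G" and H: "adj H \<subseteq> verts H \<times> verts H"
    and xs: "set xs \<subseteq> verts G"
    using assms by auto
  have ys: "set ys \<subseteq> verts H"
    using xs *(1) unfolding *(3)[symmetric] by (auto dest: bij_betw_apply)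
  have pow: "(x, v) \<in> adj G ^^ n \<longleftrightarrow> (\<phi> x, \<phi> v) \<in> adj H ^^ n"
    if "x \<in> verts G" "v \<in> verts G" for x v n
    using that
  proof (induction n arbitrary: v)
    case 0
    then show ?case using *(1) by (auto simp: bij_betw_def inj_on_def)
  next
    case (Suc n)
    show ?case
    proof
      assume "(x, v) \<in> adj G ^^ Suc n"
      then obtain u where "(x, u) \<in> adj G ^^ n" "(u, v) \<in> adj G"
        by auto
      with Suc *(2) G show "(\<phi> x, \<phi> v) \<in> adj H ^^ Suc n"
        by (metis (no_types, lifting) SigmaD1 relpow_Suc_I subsetD)
    next
      assume "(\<phi> x, \<phi> v) \<in> adj H ^^ Suc n"
      then obtain w where w: "(\<phi> x, w) \<in> adj H ^^ n" "(w, \<phi> v) \<in> adj H"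
        by auto
      with H have "w \<in> verts H"
        by auto
      with *(1) obtain u where "u \<in> verts G" "w = \<phi> u"
        by (auto simp: bij_betw_def)
      with w Suc *(2) show "(x, v) \<in> adj G ^^ Suc n"
        by (metis relpow_Suc_I)
    qed
  qed
  have sub: "nbhd_verts r A \<subseteq> verts G" "nbhd_verts r B \<subseteq> verts H"
    using nbhd_verts_subset[OF G xs] nbhd_verts_subset[OF H ys] by auto
  have mem: "v \<in> nbhd_verts r A \<longleftrightarrow> \<phi> v \<in> nbhd_verts r B" if "v \<in> verts G" for v
  proof -
    have "(x, v) \<in> adj G ^^ n \<longleftrightarrow> (\<phi> x, \<phi> v) \<in> adj H ^^ n" if "x \<in> set xs" for x n
      using pow that \<open>v \<in> verts G\<close> xs by blast
    then show ?thesis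
      by (simp add: nbhd_verts_def *(3)[symmetric])
  qed
  have "\<phi> ` nbhd_verts r A = nbhd_verts r B"
  proof
    show "\<phi> ` nbhd_verts r A \<subseteq> nbhd_verts r B"
      using mem sub by auto
    show "nbhd_verts r B \<subseteq> \<phi> ` nbhd_verts r A"
    proof
      fix w assume w: "w \<in> nbhd_verts r B"
      with sub(2) have "w \<in> \<phi> ` verts G"
        using *(1) by (auto simp: bij_betw_def)
      then obtain v where "v \<in> verts G" "w = \<phi> v"
        by blast
      with mem w show "w \<in> \<phi> ` nbhd_verts r A"
        by auto
    qed
  qed
  with *(1) sub have "bij_betw \<phi> (nbhd_verts r A) (nbhd_verts r B)"
    by (auto simp: bij_betw_def intro: inj_on_subset)
  moreover have "(u, v) \<in> adj G \<inter> nbhd_verts r A \<times> nbhd_verts r A \<longleftrightarrow>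
      (\<phi> u, \<phi> v) \<in> adj H \<inter> nbhd_verts r B \<times> nbhd_verts r B"
    if "u \<in> nbhd_verts r A" "v \<in> nbhd_verts r A" for u v
    using that sub(1) *(2)[of u v] mem[of u] mem[of v] by blast
  ultimately show ?thesis
    unfolding marked_iso_def nbhd_def prod.case AB fst_conv snd_conv
    using *(3) by blast
qed

lemma valid_markedD:
  assumes "valid_marked A"
  shows "adj (fst A) \<subseteq> verts (fst A) \<times> verts (fst A)" "set (snd A) \<subseteq> verts (fst A)"
  using assms by (auto simp: valid_marked_def simple_graph_def split: prod.splits)

definition marked_eq :: "graph \<times> nat list \<Rightarrow> graph \<times> nat list \<Rightarrow> bool" where
  "marked_eq A B \<longleftrightarrow> valid_marked A \<and> valid_marked B \<and> marked_iso A B"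

lemma marked_eq_sym: "marked_eq A B \<Longrightarrow> marked_eq B A"
  using marked_iso_sym valid_markedD by (auto simp: marked_eq_def)

lemma marked_eq_trans: "marked_eq A B \<Longrightarrow> marked_eq B C \<Longrightarrow> marked_eq A C"
  unfolding marked_eq_def using marked_iso_trans by blast

lemma valid_marked_single: "set xs \<subseteq> {0} \<Longrightarrow> valid_marked (({0}, {}), xs)"
  by (auto simp: valid_marked_def simple_graph_def connected_graph_def locally_finite_def
      sym_def irrefl_def)

definition locally_iso :: "nat \<Rightarrow> graph \<times> nat list \<Rightarrow> graph \<times> nat list \<Rightarrow> bool" where
  "locally_iso r A B \<longleftrightarrow> marked_iso (nbhd r A) (nbhd r B)"

lemma locally_iso_refl: "locally_iso r A A"
  by (simp add: locally_iso_def marked_iso_refl)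

lemma locally_iso_sym: "locally_iso r A B \<Longrightarrow> locally_iso r B A"
  unfolding locally_iso_def by (erule marked_iso_sym) (simp add: nbhd_def roots_in_nbhd)

lemma locally_iso_trans: "locally_iso r A B \<Longrightarrow> locally_iso r B C \<Longrightarrow> locally_iso r A C"
  unfolding locally_iso_def by (rule marked_iso_trans)

lemma locally_iso_mono:
  assumes "locally_iso r A B" "s \<le> r"
  shows "locally_iso s A B"
proof -
  have "marked_iso (nbhd s (nbhd r A)) (nbhd s (nbhd r B))"
    using assms(1) unfolding locally_iso_def
    by (rule marked_iso_nbhd) (auto simp: nbhd_def roots_in_nbhd[THEN subsetD])
  then show ?thesis
    using assms(2) by (simp add: nbhd_nbhd locally_iso_def)
qed

lemma marked_eq_locally_iso: "marked_eq A B \<Longrightarrow> locally_iso r A B"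
  unfolding locally_iso_def marked_eq_def
  by (auto intro!: marked_iso_nbhd dest: valid_markedD)

lemma locally_iso_cong:
  assumes "marked_eq A A'" "marked_eq B B'"
  shows "locally_iso r A B \<longleftrightarrow> locally_iso r A' B'"
  using assms marked_eq_locally_iso locally_iso_sym locally_iso_trans by meson


section \<open>The spaces of rooted and doubly rooted graphs\<close>

definition rooted_eq :: "graph \<times> nat \<Rightarrow> graph \<times> nat \<Rightarrow> bool" where
  "rooted_eq = (\<lambda>(G, x) (H, y). marked_eq (G, [x]) (H, [y]))"

quotient_type rooted_graph = "graph \<times> nat" / partial: rooted_eq
proof (rule part_equivpI)
  show "\<exists>A. rooted_eq A A"
    by (rule exI[of _ "(({0}, {}), 0)"])
      (simp add: rooted_eq_def marked_eq_def marked_iso_refl valid_marked_single)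
  show "symp rooted_eq"
    by (auto simp: rooted_eq_def intro!: sympI dest: marked_eq_sym)
  show "transp rooted_eq"
    by (auto simp: rooted_eq_def intro!: transpI dest: marked_eq_trans)
qed

definition doubly_rooted_eq :: "graph \<times> nat \<times> nat \<Rightarrow> graph \<times> nat \<times> nat \<Rightarrow> bool" where
  "doubly_rooted_eq = (\<lambda>(G, x, y) (H, x', y'). marked_eq (G, [x, y]) (H, [x', y']))"

quotient_type doubly_rooted_graph = "graph \<times> nat \<times> nat" / partial: doubly_rooted_eq
proof (rule part_equivpI)
  show "\<exists>A. doubly_rooted_eq A A"
    by (rule exI[of _ "(({0}, {}), 0, 0)"])
      (simp add: doubly_rooted_eq_def marked_eq_def marked_iso_refl valid_marked_single)
  show "symp doubly_rooted_eq"
    by (auto simp: doubly_rooted_eq_def intro!: sympI dest: marked_eq_sym)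
  show "transp doubly_rooted_eq"
    by (auto simp: doubly_rooted_eq_def intro!: transpI dest: marked_eq_trans)
qed

lift_definition agree :: "nat \<Rightarrow> rooted_graph \<Rightarrow> rooted_graph \<Rightarrow> bool"
  is "\<lambda>r (G, x) (H, y). locally_iso r (G, [x]) (H, [y])"
  by (auto simp: rooted_eq_def locally_iso_cong)

lift_definition doubly_agree :: "nat \<Rightarrow> doubly_rooted_graph \<Rightarrow> doubly_rooted_graph \<Rightarrow> bool"
  is "\<lambda>r (G, x, y) (H, x', y'). locally_iso r (G, [x, y]) (H, [x', y'])"
  by (auto simp: doubly_rooted_eq_def locally_iso_cong)

lemma agree_refl: "agree r g g"
  by transfer (auto simp: locally_iso_refl)

lemma agree_sym: "agree r g h \<Longrightarrow> agree r h g"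
  by transfer (auto dest: locally_iso_sym)

lemma agree_trans: "agree r g h \<Longrightarrow> agree r h k \<Longrightarrow> agree r g k"
  by transfer (auto dest: locally_iso_trans)

lemma agree_mono: "agree r g h \<Longrightarrow> s \<le> r \<Longrightarrow> agree s g h"
  by transfer (auto dest: locally_iso_mono)

lemma doubly_agree_refl: "doubly_agree r g g"
  by transfer (auto simp: locally_iso_refl)

lemma doubly_agree_sym: "doubly_agree r g h \<Longrightarrow> doubly_agree r h g"
  by transfer (auto dest: locally_iso_sym)

lemma doubly_agree_trans: "doubly_agree r g h \<Longrightarrow> doubly_agree r h k \<Longrightarrow> doubly_agree r g k"
  by transfer (auto dest: locally_iso_trans)

lemma doubly_agree_mono: "doubly_agree r g h \<Longrightarrow> s \<le> r \<Longrightarrow> doubly_agree s g h"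
  by transfer (auto dest: locally_iso_mono)

text \<open>
  The topologies of local convergence. That the basic neighbourhoods are those given by agreement
  up to radius \<open>r\<close> is the content of the lemmas \<open>tendsto_rooted_graph_iff\<close> and
  \<open>tendsto_doubly_rooted_graph_iff\<close> below.
\<close>

instantiation rooted_graph :: topological_space
begin

definition open_rooted_graph :: "rooted_graph set \<Rightarrow> bool" where
  "open_rooted_graph U \<longleftrightarrow> (\<forall>g\<in>U. \<exists>r. \<forall>h. agree r g h \<longrightarrow> h \<in> U)"

instance
proof
  fix S T :: "rooted_graph set"
  assume S: "open S" and T: "open T"
  show "open (S \<inter> T)"
    unfolding open_rooted_graph_def
  proof
    fix g assume "g \<in> S \<inter> T"
    with S T obtain r s where
      "\<And>h. agree r g h \<Longrightarrow> h \<in> S" "\<And>h. agree s g h \<Longrightarrow> h \<in> T"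
      unfolding open_rooted_graph_def by blast
    then show "\<exists>r. \<forall>h. agree r g h \<longrightarrow> h \<in> S \<inter> T"
      using agree_mono[OF _ max.cobounded1] agree_mono[OF _ max.cobounded2] by blast
  qed
next
  fix K :: "rooted_graph set set"
  assume "\<forall>S\<in>K. open S"
  then show "open (\<Union>K)"
    unfolding open_rooted_graph_def by (metis UnionE UnionI)
qed (auto simp: open_rooted_graph_def)

end

instantiation doubly_rooted_graph :: topological_space
begin

definition open_doubly_rooted_graph :: "doubly_rooted_graph set \<Rightarrow> bool" where
  "open_doubly_rooted_graph U \<longleftrightarrow> (\<forall>g\<in>U. \<exists>r. \<forall>h. doubly_agree r g h \<longrightarrow> h \<in> U)"

instance
proof
  fix S T :: "doubly_rooted_graph set"
  assume S: "open S" and T: "open T"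
  show "open (S \<inter> T)"
    unfolding open_doubly_rooted_graph_def
  proof
    fix g assume "g \<in> S \<inter> T"
    with S T obtain r s where
      "\<And>h. doubly_agree r g h \<Longrightarrow> h \<in> S" "\<And>h. doubly_agree s g h \<Longrightarrow> h \<in> T"
      unfolding open_doubly_rooted_graph_def by blast
    then show "\<exists>r. \<forall>h. doubly_agree r g h \<longrightarrow> h \<in> S \<inter> T"
      using doubly_agree_mono[OF _ max.cobounded1] doubly_agree_mono[OF _ max.cobounded2] by blast
  qed
next
  fix K :: "doubly_rooted_graph set set"
  assume "\<forall>S\<in>K. open S"
  then show "open (\<Union>K)"
    unfolding open_doubly_rooted_graph_def by (metis UnionE UnionI)
qed (auto simp: open_doubly_rooted_graph_def)

end

lemma tendsto_rooted_graph_iff: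
  fixes g :: rooted_graph
  shows "(X \<longlongrightarrow> g) F \<longleftrightarrow> (\<forall>r. \<forall>\<^sub>F n in F. agree r g (X n))"
proof
  assume X: "(X \<longlongrightarrow> g) F"
  show "\<forall>r. \<forall>\<^sub>F n in F. agree r g (X n)"
  proof
    fix r
    have "open {h. agree r g h}"
      unfolding open_rooted_graph_def using agree_trans by blast
    then show "\<forall>\<^sub>F n in F. agree r g (X n)"
      using topological_tendstoD[OF X] agree_refl by fastforce
  qed
next
  assume X: "\<forall>r. \<forall>\<^sub>F n in F. agree r g (X n)"
  show "(X \<longlongrightarrow> g) F"
  proof (rule topological_tendstoI)
    fix S :: "rooted_graph set"
    assume "open S" "g \<in> S"
    then obtain r where r: "\<And>h. agree r g h \<Longrightarrow> h \<in> S"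
      unfolding open_rooted_graph_def by blast
    from X have "\<forall>\<^sub>F n in F. agree r g (X n)"
      by blast
    then show "\<forall>\<^sub>F n in F. X n \<in> S"
      by (rule eventually_mono) (rule r)
  qed
qed

lemma tendsto_doubly_rooted_graph_iff:
  fixes g :: doubly_rooted_graph
  shows "(X \<longlongrightarrow> g) F \<longleftrightarrow> (\<forall>r. \<forall>\<^sub>F n in F. doubly_agree r g (X n))"
proof
  assume X: "(X \<longlongrightarrow> g) F"
  show "\<forall>r. \<forall>\<^sub>F n in F. doubly_agree r g (X n)"
  proof
    fix r
    have "open {h. doubly_agree r g h}"
      unfolding open_doubly_rooted_graph_def using doubly_agree_trans by blast
    then show "\<forall>\<^sub>F n in F. doubly_agree r g (X n)"
      using topological_tendstoD[OF X] doubly_agree_refl by fastforce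
  qed
next
  assume X: "\<forall>r. \<forall>\<^sub>F n in F. doubly_agree r g (X n)"
  show "(X \<longlongrightarrow> g) F"
  proof (rule topological_tendstoI)
    fix S :: "doubly_rooted_graph set"
    assume "open S" "g \<in> S"
    then obtain r where r: "\<And>h. doubly_agree r g h \<Longrightarrow> h \<in> S"
      unfolding open_doubly_rooted_graph_def by blast
    from X have "\<forall>\<^sub>F n in F. doubly_agree r g (X n)"
      by blast
    then show "\<forall>\<^sub>F n in F. X n \<in> S"
      by (rule eventually_mono) (rule r)
  qed
qed


section \<open>Functions of an isomorphism class\<close>

lemma rooted_eqE:
  assumes "rooted_eq (G, x) (H, y)"
  obtains \<phi> where "bij_betw \<phi> (verts G) (verts H)"
    "\<And>u v. u \<in> verts G \<Longrightarrow> v \<in> verts G \<Longrightarrow> (u, v) \<in> adj G \<longleftrightarrow> (\<phi> u, \<phi> v) \<in> adj H"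
    "\<phi> x = y" "x \<in> verts G" "y \<in> verts H"
    "simple_graph G" "simple_graph H"
    "connected_graph G" "connected_graph H" "locally_finite G" "locally_finite H"
  using assms by (auto simp: rooted_eq_def marked_eq_def marked_iso_def valid_marked_def)

lemma vertex_degree_iso:
  assumes \<phi>: "bij_betw \<phi> (verts G) (verts H)"
    "\<And>u v. u \<in> verts G \<Longrightarrow> v \<in> verts G \<Longrightarrow> (u, v) \<in> adj G \<longleftrightarrow> (\<phi> u, \<phi> v) \<in> adj H"
    and "simple_graph G" "simple_graph H" "v \<in> verts G"
  shows "vertex_degree H (\<phi> v) = vertex_degree G v"
proof -
  have G: "adj G \<subseteq> verts G \<times> verts G" and H: "adj H \<subseteq> verts H \<times> verts H"
    using assms by (auto simp: simple_graph_def)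
  have "\<phi> ` (adj G `` {v}) = adj H `` {\<phi> v}"
  proof
    show "\<phi> ` (adj G `` {v}) \<subseteq> adj H `` {\<phi> v}"
      using \<phi>(2) G by auto
    show "adj H `` {\<phi> v} \<subseteq> \<phi> ` (adj G `` {v})"
    proof
      fix w assume w: "w \<in> adj H `` {\<phi> v}"
      with H have "w \<in> verts H"
        by auto
      with \<phi>(1) obtain u where "u \<in> verts G" "w = \<phi> u"
        by (auto simp: bij_betw_def)
      with w \<phi>(2) assms(5) show "w \<in> \<phi> ` (adj G `` {v})"
        by auto
    qed
  qed
  moreover have "inj_on \<phi> (adj G `` {v})"
    using \<phi>(1) G by (auto simp: bij_betw_def intro: inj_on_subset)
  ultimately show ?thesis
    unfolding vertex_degree_def using card_image by metis
qed

lift_definition root_degree :: "rooted_graph \<Rightarrow> nat"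
  is "\<lambda>(G, x). vertex_degree G x"
proof clarify
  fix V E x W F y
  assume "rooted_eq ((V, E), x) ((W, F), y)"
  then show "vertex_degree (V, E) x = vertex_degree (W, F) y"
  proof (rule rooted_eqE)
    fix \<phi>
    assume \<phi>: "bij_betw \<phi> (verts (V, E)) (verts (W, F))"
      "\<And>u v. u \<in> verts (V, E) \<Longrightarrow> v \<in> verts (V, E) \<Longrightarrow>
         (u, v) \<in> adj (V, E) \<longleftrightarrow> (\<phi> u, \<phi> v) \<in> adj (W, F)"
      and x: "\<phi> x = y" "x \<in> verts (V, E)"
      and s: "simple_graph (V, E)" "simple_graph (W, F)"
    show ?thesis
      using vertex_degree_iso[OF \<phi> s x(2)] x(1) by simp
  qed
qed

lift_definition no_leaves :: "rooted_graph \<Rightarrow> bool"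
  is "\<lambda>(G, x). \<forall>v\<in>verts G. vertex_degree G v \<ge> 2"
proof clarsimp
  fix V E x W F y
  assume "rooted_eq ((V, E), x) ((W, F), y)"
  then show "(\<forall>v\<in>V. 2 \<le> vertex_degree (V, E) v) \<longleftrightarrow> (\<forall>v\<in>W. 2 \<le> vertex_degree (W, F) v)"
  proof (rule rooted_eqE)
    fix \<phi>
    assume \<phi>: "bij_betw \<phi> (verts (V, E)) (verts (W, F))"
      "\<And>u v. u \<in> verts (V, E) \<Longrightarrow> v \<in> verts (V, E) \<Longrightarrow>
         (u, v) \<in> adj (V, E) \<longleftrightarrow> (\<phi> u, \<phi> v) \<in> adj (W, F)"
      and s: "simple_graph (V, E)" "simple_graph (W, F)"
    have "vertex_degree (W, F) (\<phi> v) = vertex_degree (V, E) v" if "v \<in> V" for v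
      by (rule vertex_degree_iso[OF \<phi> s]) (use that in simp_all)
    moreover have "W = \<phi> ` V"
      using \<phi>(1) by (simp add: bij_betw_def)
    ultimately show ?thesis
      by simp
  qed
qed

text \<open>
  The walk \<open>w\<^sub>0, \<dots>, w\<^sub>r\<close> is represented as a list of length \<open>r + 1\<close>. The set of these walks is
  finite since \<open>G\<close> is locally finite, so \<open>card\<close> is its true cardinality.
\<close>

definition NBW :: "nat \<Rightarrow> graph \<Rightarrow> nat \<Rightarrow> nat list set" where
  "NBW r G x = {w. length w = r + 1 \<and> set w \<subseteq> verts G \<and> w ! 0 = x
     \<and> (\<forall>i\<in>{1..r}. (w ! (i - 1), w ! i) \<in> adj G)
     \<and> (\<forall>i\<in>{1..r - 1}. w ! (i + 1) \<noteq> w ! (i - 1))}"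

lemma NBW_map:
  assumes \<phi>: "bij_betw \<phi> (verts G) (verts H)"
    "\<And>u v. u \<in> verts G \<Longrightarrow> v \<in> verts G \<Longrightarrow> (u, v) \<in> adj G \<longleftrightarrow> (\<phi> u, \<phi> v) \<in> adj H"
    and x: "x \<in> verts G" and w: "set w \<subseteq> verts G"
  shows "map \<phi> w \<in> NBW r H (\<phi> x) \<longleftrightarrow> w \<in> NBW r G x"
proof (cases "length w = r + 1")
  case True
  have m: "w ! i \<in> verts G" if "i \<le> r" for i
    using w True that nth_mem[of i w] by fastforce
  have inj: "\<phi> u = \<phi> v \<longleftrightarrow> u = v" if "u \<in> verts G" "v \<in> verts G" for u v
    using \<phi>(1) that by (auto simp: bij_betw_def inj_on_def)
  have 1: "map \<phi> w ! 0 = \<phi> x \<longleftrightarrow> w ! 0 = x"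
    using True m[of 0] x inj by simp
  have 2: "(map \<phi> w ! (i - 1), map \<phi> w ! i) \<in> adj H \<longleftrightarrow> (w ! (i - 1), w ! i) \<in> adj G"
    if "i \<in> {1..r}" for i
  proof -
    have "i \<le> r" "i - 1 \<le> r" using that by auto
    with True m[of i] m[of "i - 1"] show ?thesis
      using \<phi>(2)[of "w ! (i - 1)" "w ! i"] by simp
  qed
  have 3: "map \<phi> w ! (i + 1) \<noteq> map \<phi> w ! (i - 1) \<longleftrightarrow> w ! (i + 1) \<noteq> w ! (i - 1)"
    if "i \<in> {1..r - 1}" for i
  proof -
    have "i + 1 \<le> r" "i - 1 \<le> r" using that by auto
    with True m show ?thesis using inj by simp
  qed
  have 4: "set (map \<phi> w) \<subseteq> verts H"
    using w \<phi>(1) by (auto dest: bij_betw_apply)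
  show ?thesis
    unfolding NBW_def mem_Collect_eq using 1 2 3 4 w True by simp
qed (simp add: NBW_def)

lemma card_NBW_iso:
  assumes \<phi>: "bij_betw \<phi> (verts G) (verts H)"
    "\<And>u v. u \<in> verts G \<Longrightarrow> v \<in> verts G \<Longrightarrow> (u, v) \<in> adj G \<longleftrightarrow> (\<phi> u, \<phi> v) \<in> adj H"
    and x: "x \<in> verts G"
  shows "card (NBW r H (\<phi> x)) = card (NBW r G x)"
proof -
  have "map \<phi> ` NBW r G x = NBW r H (\<phi> x)"
  proof
    show "map \<phi> ` NBW r G x \<subseteq> NBW r H (\<phi> x)"
    proof
      fix w assume "w \<in> map \<phi> ` NBW r G x"
      then obtain u where "w = map \<phi> u" "u \<in> NBW r G x"
        by auto
      moreover from this have "set u \<subseteq> verts G"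
        by (simp add: NBW_def)
      ultimately show "w \<in> NBW r H (\<phi> x)"
        using NBW_map[OF \<phi> x] by blast
    qed
    show "NBW r H (\<phi> x) \<subseteq> map \<phi> ` NBW r G x"
    proof
      fix w assume w: "w \<in> NBW r H (\<phi> x)"
      then have ws: "set w \<subseteq> \<phi> ` verts G"
        using \<phi>(1) by (auto simp: NBW_def bij_betw_def)
      let ?u = "map (inv_into (verts G) \<phi>) w"
      have "\<phi> (inv_into (verts G) \<phi> v) = v" if "v \<in> set w" for v
        using ws that by (blast intro: f_inv_into_f)
      then have "map \<phi> ?u = w"
        by (simp add: map_idI)
      moreover have "set ?u \<subseteq> verts G"
        using ws by (auto intro!: inv_into_into)
      ultimately show "w \<in> map \<phi> ` NBW r G x"
        using NBW_map[OF \<phi> x, of ?u] w by (metis image_eqI)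
    qed
  qed
  moreover have "inj_on (map \<phi>) (NBW r G x)"
    by (rule inj_on_mapI) (use \<phi>(1) in \<open>auto simp: NBW_def bij_betw_def intro: inj_on_subset\<close>)
  ultimately show ?thesis
    by (metis card_image)
qed

lift_definition NBW_count :: "nat \<Rightarrow> rooted_graph \<Rightarrow> nat"
  is "\<lambda>r (G, x). card (NBW r G x)"
proof clarify
  fix r V E x W F y
  assume "rooted_eq ((V, E), x) ((W, F), y)"
  then show "card (NBW r (V, E) x) = card (NBW r (W, F) y)"
  proof (rule rooted_eqE)
    fix \<phi>
    assume \<phi>: "bij_betw \<phi> (verts (V, E)) (verts (W, F))"
      "\<And>u v. u \<in> verts (V, E) \<Longrightarrow> v \<in> verts (V, E) \<Longrightarrow>
         (u, v) \<in> adj (V, E) \<longleftrightarrow> (\<phi> u, \<phi> v) \<in> adj (W, F)"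
      and x: "\<phi> x = y" "x \<in> verts (V, E)"
    show ?thesis
      using card_NBW_iso[OF \<phi> x(2)] x(1) by simp
  qed
qed


section \<open>Unimodular networks\<close>

lemma doubly_rooted_eqI:
  assumes "rooted_eq (G, x) (H, y)" and "bij_betw \<phi> (verts G) (verts H)"
    "\<And>u v. u \<in> verts G \<Longrightarrow> v \<in> verts G \<Longrightarrow> (u, v) \<in> adj G \<longleftrightarrow> (\<phi> u, \<phi> v) \<in> adj H"
    "u \<in> verts G" "v \<in> verts G"
  shows "doubly_rooted_eq (G, u, v) (H, \<phi> u, \<phi> v)"
proof -
  have "\<phi> u \<in> verts H" "\<phi> v \<in> verts H"
    using assms by (auto dest: bij_betw_apply)
  with assms have "valid_marked (G, [u, v])" "valid_marked (H, [\<phi> u, \<phi> v])"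
    by (auto simp: rooted_eq_def marked_eq_def valid_marked_def)
  moreover have "marked_iso (G, [u, v]) (H, [\<phi> u, \<phi> v])"
    unfolding marked_iso_def prod.case using assms(2,3) by (intro exI[of _ \<phi>]) simp
  ultimately show ?thesis
    by (simp add: doubly_rooted_eq_def marked_eq_def)
qed

text \<open>
  The sums over all \<open>v \<in> V(G)\<close> of \<open>f(G, x, v)\<close> and of \<open>f(G, v, x)\<close>, where \<open>x\<close> is the root of \<open>G\<close>.
\<close>

lift_definition sum_from_root :: "(doubly_rooted_graph \<Rightarrow> ennreal) \<Rightarrow> rooted_graph \<Rightarrow> ennreal"
  is "\<lambda>f (G, x). \<integral>\<^sup>+v. f (abs_doubly_rooted_graph (G, x, v)) \<partial>count_space (verts G)"
proof clarify
  fix f :: "doubly_rooted_graph \<Rightarrow> ennreal" and V E x W F y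
  assume eq: "rooted_eq ((V, E), x) ((W, F), y)"
  then obtain \<phi> where \<phi>: "bij_betw \<phi> V W"
    "\<And>u v. u \<in> V \<Longrightarrow> v \<in> V \<Longrightarrow> (u, v) \<in> E \<longleftrightarrow> (\<phi> u, \<phi> v) \<in> F" "\<phi> x = y" "x \<in> V"
    by (rule rooted_eqE) auto
  have *: "abs_doubly_rooted_graph ((V, E), x, v) = abs_doubly_rooted_graph ((W, F), y, \<phi> v)"
    if "v \<in> V" for v
    using doubly_rooted_eqI[OF eq, of \<phi> x v] \<phi> that
    by (auto intro: Quotient3_rel_abs[OF Quotient3_doubly_rooted_graph])
  show "(\<integral>\<^sup>+v. f (abs_doubly_rooted_graph ((V, E), x, v)) \<partial>count_space (verts (V, E))) =
      (\<integral>\<^sup>+v. f (abs_doubly_rooted_graph ((W, F), y, v)) \<partial>count_space (verts (W, F)))"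
    unfolding fst_conv
    by (subst nn_integral_bij_count_space[OF \<phi>(1), symmetric])
      (auto intro!: nn_integral_cong simp: *)
qed

lift_definition sum_to_root :: "(doubly_rooted_graph \<Rightarrow> ennreal) \<Rightarrow> rooted_graph \<Rightarrow> ennreal"
  is "\<lambda>f (G, x). \<integral>\<^sup>+v. f (abs_doubly_rooted_graph (G, v, x)) \<partial>count_space (verts G)"
proof clarify
  fix f :: "doubly_rooted_graph \<Rightarrow> ennreal" and V E x W F y
  assume eq: "rooted_eq ((V, E), x) ((W, F), y)"
  then obtain \<phi> where \<phi>: "bij_betw \<phi> V W"
    "\<And>u v. u \<in> V \<Longrightarrow> v \<in> V \<Longrightarrow> (u, v) \<in> E \<longleftrightarrow> (\<phi> u, \<phi> v) \<in> F" "\<phi> x = y" "x \<in> V"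
    by (rule rooted_eqE) auto
  have *: "abs_doubly_rooted_graph ((V, E), v, x) = abs_doubly_rooted_graph ((W, F), \<phi> v, y)"
    if "v \<in> V" for v
    using doubly_rooted_eqI[OF eq, of \<phi> v x] \<phi> that
    by (auto intro: Quotient3_rel_abs[OF Quotient3_doubly_rooted_graph])
  show "(\<integral>\<^sup>+v. f (abs_doubly_rooted_graph ((V, E), v, x)) \<partial>count_space (verts (V, E))) =
      (\<integral>\<^sup>+v. f (abs_doubly_rooted_graph ((W, F), v, y)) \<partial>count_space (verts (W, F)))"
    unfolding fst_conv
    by (subst nn_integral_bij_count_space[OF \<phi>(1), symmetric])
      (auto intro!: nn_integral_cong simp: *)
qed

definition random_rooted_graph :: "'w measure \<Rightarrow> ('w \<Rightarrow> rooted_graph) \<Rightarrow> bool" where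
  "random_rooted_graph M X \<longleftrightarrow> prob_space M \<and> X \<in> borel_measurable M"

definition unimodular_network :: "'w measure \<Rightarrow> ('w \<Rightarrow> rooted_graph) \<Rightarrow> bool" where
  "unimodular_network M X \<longleftrightarrow> random_rooted_graph M X \<and>
     (\<forall>f \<in> borel_measurable borel.
        (\<integral>\<^sup>+\<omega>. sum_from_root f (X \<omega>) \<partial>M) = (\<integral>\<^sup>+\<omega>. sum_to_root f (X \<omega>) \<partial>M))"

end

(* Let d be the expected degree. In the measure that gives mass 1 to every directed edge leaving
   the root, run the non-backtracking random walk. Mass transport makes this measure stationary,
   so the expected entropy of n steps is n E[deg ln(deg - 1)], which is at least n d ln(d - 1) by
   convexity of x ln(x - 1) on [2, oo). On every graph the number of walks is at least the
   exponential of the entropy. That exponential is replaced by its tangent at n ln(d - 1), which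
   turns the bound into one that is affine in degree and entropy and needs no integrability of
   deg ln(deg - 1). Functions that only depend on a ball of fixed radius are locally constant,
   hence measurable. *)
theory Submission
  imports Defs
begin

section \<open>Local functions\<close>

lemma nbhd_verts_mono: "k \<le> R \<Longrightarrow> nbhd_verts k A \<subseteq> nbhd_verts R A"
  by (auto simp: nbhd_verts_def intro: order_trans)

lemma nbhd_verts_adj:
  assumes "v \<in> nbhd_verts k (G, xs)" "(v, w) \<in> adj G"
  shows "w \<in> nbhd_verts (Suc k) (G, xs)"
proof -
  obtain x n where "x \<in> set xs" "n \<le> k" "(x, v) \<in> adj G ^^ n"
    using assms(1) by (auto simp: nbhd_verts_def)
  then have "(x, w) \<in> adj G ^^ Suc n" "Suc n \<le> Suc k"
    using assms(2) by auto
  with \<open>x \<in> set xs\<close> show ?thesis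
    unfolding nbhd_verts_def by blast
qed

text \<open>An isomorphism of induced balls says nothing about edges leaving the ball. A vertex at
  distance less than \<open>R\<close> has all its neighbours inside, and walks from the roots map to
  walks of the same length, so whole neighbourhoods correspond. Degrees and continuations of walks
  can then be compared.\<close>

lemma locally_iso_neighboursE:
  assumes "locally_iso R (G, xs) (H, ys)"
  obtains \<phi> where "map \<phi> xs = ys" "inj_on \<phi> (nbhd_verts R (G, xs))"
    "\<And>k v. k < R \<Longrightarrow> v \<in> nbhd_verts k (G, xs) \<Longrightarrow> \<phi> ` (adj G `` {v}) = adj H `` {\<phi> v}"
proof -
  let ?B = "\<lambda>k. nbhd_verts k (G, xs)" and ?C = "\<lambda>k. nbhd_verts k (H, ys)"
  obtain \<phi> where bij: "bij_betw \<phi> (?B R) (?C R)"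
    and adj: "\<And>u v. u \<in> ?B R \<Longrightarrow> v \<in> ?B R \<Longrightarrow>
      (u, v) \<in> adj G \<inter> ?B R \<times> ?B R \<longleftrightarrow> (\<phi> u, \<phi> v) \<in> adj H \<inter> ?C R \<times> ?C R"
    and ys: "map \<phi> xs = ys"
    using assms by (auto simp: locally_iso_def marked_iso_def nbhd_def)
  have pow: "(\<phi> x, \<phi> v) \<in> adj H ^^ n" if "(x, v) \<in> adj G ^^ n" "n \<le> R" "x \<in> set xs" for x v n
    using that
  proof (induction n arbitrary: v)
    case (Suc n)
    then obtain u where u: "(x, u) \<in> adj G ^^ n" "(u, v) \<in> adj G"
      by auto
    then have un: "u \<in> ?B n"
      using Suc.prems(3) by (auto simp: nbhd_verts_def)
    with Suc.prems(2) have "u \<in> ?B R" "v \<in> ?B R"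
      using nbhd_verts_adj[OF un u(2)] nbhd_verts_mono[of n R "(G, xs)"] nbhd_verts_mono[of "Suc n" R "(G, xs)"]
      by auto
    with adj u(2) have "(\<phi> u, \<phi> v) \<in> adj H"
      by blast
    with Suc u(1) show ?case
      by auto
  qed auto
  have image: "\<phi> v \<in> ?C k" if v: "v \<in> ?B k" and k: "k \<le> R" for k v
  proof -
    obtain x n where x: "x \<in> set xs" "n \<le> k" "(x, v) \<in> adj G ^^ n"
      using v by (auto simp: nbhd_verts_def)
    then have "(\<phi> x, \<phi> v) \<in> adj H ^^ n"
      using pow k by auto
    moreover have "\<phi> x \<in> set ys"
      using x(1) ys by auto
    ultimately show ?thesis
      using x(2) by (auto simp: nbhd_verts_def)
  qed
  show ?thesis
  proof
    show "map \<phi> xs = ys" "inj_on \<phi> (?B R)"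
      using ys bij by (auto simp: bij_betw_def)
  next
    fix k v assume k: "k < R" and v: "v \<in> ?B k"
    have vR: "v \<in> ?B R"
      using v k nbhd_verts_mono[of k R "(G, xs)"] by auto
    show "\<phi> ` (adj G `` {v}) = adj H `` {\<phi> v}"
    proof safe
      fix w assume w: "(v, w) \<in> adj G"
      then have "w \<in> ?B R"
        using nbhd_verts_adj[OF v w] nbhd_verts_mono[of "Suc k" R "(G, xs)"] k by auto
      with adj[OF vR this] w vR show "(\<phi> v, \<phi> w) \<in> adj H"
        by blast
    next
      fix w assume w: "(\<phi> v, w) \<in> adj H"
      then have wR: "w \<in> ?C R"
        using nbhd_verts_adj[OF image[OF v] w] nbhd_verts_mono[of "Suc k" R "(H, ys)"] k by auto
      then obtain u where u: "u \<in> ?B R" "w = \<phi> u"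
        using bij by (auto simp: bij_betw_def)
      then have "(v, u) \<in> adj G"
        using adj[OF vR u(1)] w wR image[OF vR] by blast
      with u(2) show "w \<in> \<phi> ` (adj G `` {v})"
        by blast
    qed
  qed
qed

text \<open>Such an \<open>f\<close> is locally constant in the topology of local convergence, so
  the preimage of any set whatsoever is open.\<close>

lemma borel_measurable_rooted_local:
  fixes f :: "rooted_graph \<Rightarrow> 'b :: topological_space"
  assumes "\<And>g h. agree R g h \<Longrightarrow> f g = f h"
  shows "f \<in> borel_measurable borel"
proof (rule borel_measurableI)
  fix S :: "'b set"
  have "open (f -` S)"
    unfolding open_rooted_graph_def using assms by (metis vimage_eq)
  then show "f -` S \<inter> space borel \<in> sets borel"
    by simp
qed

lemma borel_measurable_doubly_rooted_local:
  fixes f :: "doubly_rooted_graph \<Rightarrow> 'b :: topological_space"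
  assumes "\<And>g h. doubly_agree R g h \<Longrightarrow> f g = f h"
  shows "f \<in> borel_measurable borel"
proof (rule borel_measurableI)
  fix S :: "'b set"
  have "open (f -` S)"
    unfolding open_doubly_rooted_graph_def using assms by (metis vimage_eq)
  then show "f -` S \<inter> space borel \<in> sets borel"
    by simp
qed


section \<open>The entropy of the non-backtracking random walk\<close>

text \<open>
  \<open>nbrw_entropy n G x y\<close> is the Shannon entropy of \<open>n\<close> further steps of the non-backtracking
  random walk that has just traversed the edge from \<open>x\<close> to \<open>y\<close>, on a graph without leaves.
\<close>

primrec nbrw_entropy :: "nat \<Rightarrow> graph \<Rightarrow> nat \<Rightarrow> nat \<Rightarrow> real" where
  "nbrw_entropy 0 G x y = 0"
| "nbrw_entropy (Suc n) G x y = ln (real (vertex_degree G y) - 1)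
     + (\<Sum>z\<in>adj G `` {y} - {x}. nbrw_entropy n G y z) / (real (vertex_degree G y) - 1)"

text \<open>A walk of \<open>n\<close> steps from distance at most \<open>k\<close> consults only
  neighbourhoods of vertices at distance less than \<open>n + k\<close>; the induction trades one
  unit of \<open>n\<close> for one of \<open>k\<close>. The vertex \<open>x\<close> lies where
  \<open>\<phi>\<close> is injective, so that excluding \<open>x\<close> corresponds to excluding
  \<open>\<phi> x\<close>.\<close>

lemma nbrw_entropy_local:
  assumes inj: "inj_on \<phi> (nbhd_verts R (G, xs))"
    and nb: "\<And>k v. k < R \<Longrightarrow> v \<in> nbhd_verts k (G, xs) \<Longrightarrow> \<phi> ` (adj G `` {v}) = adj H `` {\<phi> v}"
    and "n + k \<le> R" "x \<in> nbhd_verts R (G, xs)" "y \<in> nbhd_verts k (G, xs)"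
  shows "nbrw_entropy n G x y = nbrw_entropy n H (\<phi> x) (\<phi> y)"
  using assms(3-)
proof (induction n arbitrary: k x y)
  case (Suc n)
  let ?N = "adj G `` {y}"
  have k: "k < R"
    using Suc.prems(1) by simp
  have N_next: "?N \<subseteq> nbhd_verts (Suc k) (G, xs)"
    using nbhd_verts_adj[OF Suc.prems(3)] by auto
  then have N: "?N \<subseteq> nbhd_verts R (G, xs)"
    using nbhd_verts_mono[of "Suc k" R "(G, xs)"] k by fastforce
  have y: "y \<in> nbhd_verts R (G, xs)"
    using nbhd_verts_mono[of k R "(G, xs)"] k Suc.prems(3) by auto
  have image: "\<phi> ` ?N = adj H `` {\<phi> y}"
    using nb[OF k Suc.prems(3)] .
  have deg: "vertex_degree H (\<phi> y) = vertex_degree G y"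
    unfolding vertex_degree_def image[symmetric] by (rule card_image[OF inj_on_subset[OF inj N]])
  have "adj H `` {\<phi> y} - {\<phi> x} = \<phi> ` (?N - {x})"
    using inj_on_image_set_diff[OF inj, of ?N "{x}"] N Suc.prems(2) image by auto
  then have "(\<Sum>z\<in>adj H `` {\<phi> y} - {\<phi> x}. nbrw_entropy n H (\<phi> y) z)
      = (\<Sum>z\<in>?N - {x}. nbrw_entropy n H (\<phi> y) (\<phi> z))"
    using N by (simp add: sum.reindex[OF inj_on_subset[OF inj]] subset_iff)
  also have "\<dots> = (\<Sum>z\<in>?N - {x}. nbrw_entropy n G y z)"
    using Suc.IH[of "Suc k" y] N_next y Suc.prems(1) by (intro sum.cong) (auto simp: subset_iff)
  finally show ?case
    using deg by simp
qed simp

text \<open>The radius \<open>Suc n\<close> is positive even for \<open>n = 0\<close>, so the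
  neighbourhood of \<open>x\<close> is carried over whole and the edge test can be read off from
  it.\<close>

lemma locally_iso_edge_entropy:
  assumes "locally_iso (Suc n) (G, [x, y]) (H, [x', y'])"
  shows "(if (x, y) \<in> adj G then ennreal (nbrw_entropy n G x y) else 0) =
    (if (x', y') \<in> adj H then ennreal (nbrw_entropy n H x' y') else 0)"
proof -
  let ?B = "\<lambda>k. nbhd_verts k (G, [x, y])"
  obtain \<phi> where \<phi>: "map \<phi> [x, y] = [x', y']" and inj: "inj_on \<phi> (?B (Suc n))"
    and nb: "\<And>k v. k < Suc n \<Longrightarrow> v \<in> ?B k \<Longrightarrow> \<phi> ` (adj G `` {v}) = adj H `` {\<phi> v}"
    using locally_iso_neighboursE[OF assms] by blast
  have roots: "x \<in> ?B k" "y \<in> ?B k" for k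
    using roots_in_nbhd[of "(G, [x, y])" k] by auto
  have "adj G `` {x} \<subseteq> ?B (Suc n)"
    using nbhd_verts_adj[OF roots(1)[of n]] by auto
  then have "(x, y) \<in> adj G \<longleftrightarrow> (x', y') \<in> adj H"
    using nb[of 0 x] roots \<phi> inj_on_image_mem_iff[OF inj roots(2), of "adj G `` {x}"] by auto
  moreover have "nbrw_entropy n G x y = nbrw_entropy n H x' y'"
    using nbrw_entropy_local[OF inj nb, where n = n and k = 0 and x = x and y = y] roots \<phi> by auto
  ultimately show ?thesis
    by simp
qed

text \<open>The first edge already leads to distance 1 from the only root, so locality is applied
  with \<open>k = 1\<close> and total radius \<open>n + 1\<close>.\<close>

lemma locally_iso_root_entropy:
  assumes "locally_iso (Suc n) (G, [x]) (H, [x'])"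
  shows "(\<Sum>y\<in>adj G `` {x}. nbrw_entropy n G x y) = (\<Sum>y\<in>adj H `` {x'}. nbrw_entropy n H x' y)"
proof -
  let ?B = "\<lambda>k. nbhd_verts k (G, [x])"
  obtain \<phi> where \<phi>: "map \<phi> [x] = [x']" and inj: "inj_on \<phi> (?B (Suc n))"
    and nb: "\<And>k v. k < Suc n \<Longrightarrow> v \<in> ?B k \<Longrightarrow> \<phi> ` (adj G `` {v}) = adj H `` {\<phi> v}"
    using locally_iso_neighboursE[OF assms] by blast
  have root: "x \<in> ?B k" for k
    using roots_in_nbhd[of "(G, [x])" k] by auto
  have N1: "adj G `` {x} \<subseteq> ?B 1"
    using nbhd_verts_adj[OF root[of 0]] by auto
  then have N: "adj G `` {x} \<subseteq> ?B (Suc n)"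
    using nbhd_verts_mono[of 1 "Suc n" "(G, [x])"] by fastforce
  have "adj H `` {x'} = \<phi> ` (adj G `` {x})"
    using nb[of 0 x] root \<phi> by auto
  then have "(\<Sum>y\<in>adj H `` {x'}. nbrw_entropy n H x' y)
      = (\<Sum>y\<in>adj G `` {x}. nbrw_entropy n H x' (\<phi> y))"
    by (simp add: sum.reindex[OF inj_on_subset[OF inj N]])
  also have "\<dots> = (\<Sum>y\<in>adj G `` {x}. nbrw_entropy n G x y)"
    using nbrw_entropy_local[OF inj nb, where n = n and k = 1 and x = x] root \<phi> N1 by (intro sum.cong) auto
  finally show ?thesis ..
qed

text \<open>This is the mass that \<open>x\<close> sends to \<open>y\<close> in the mass transport.
  It vanishes off edges, so sums over all vertices reduce to finite sums over neighbours.\<close>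

lift_definition edge_entropy :: "nat \<Rightarrow> doubly_rooted_graph \<Rightarrow> ennreal"
  is "\<lambda>n (G, x, y). if (x, y) \<in> adj G then ennreal (nbrw_entropy n G x y) else 0"
  by (clarsimp simp only: doubly_rooted_eq_def prod.case)
    (rule locally_iso_edge_entropy[OF marked_eq_locally_iso])

text \<open>The total mass sent out by the root. It is kept real-valued because the tangent bound
  for the number of walks involves a subtraction.\<close>

lift_definition root_entropy :: "nat \<Rightarrow> rooted_graph \<Rightarrow> real"
  is "\<lambda>n (G, x). \<Sum>y\<in>adj G `` {x}. nbrw_entropy n G x y"
  by (clarsimp simp only: rooted_eq_def prod.case)
    (rule locally_iso_root_entropy[OF marked_eq_locally_iso])

lemma borel_measurable_edge_entropy: "edge_entropy n \<in> borel_measurable borel"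
proof (rule borel_measurable_doubly_rooted_local)
  show "edge_entropy n g = edge_entropy n h" if "doubly_agree (Suc n) g h" for g h
    using that by transfer (clarsimp simp only: prod.case, rule locally_iso_edge_entropy)
qed

lemma borel_measurable_root_entropy: "root_entropy n \<in> borel_measurable borel"
proof (rule borel_measurable_rooted_local)
  show "root_entropy n g = root_entropy n h" if "agree (Suc n) g h" for g h
    using that by transfer (clarsimp simp only: prod.case, rule locally_iso_root_entropy)
qed

section \<open>Positivity of the entropy and stationarity of the walk\<close>

lemma nbrw_entropy_nonneg:
  assumes "adj G \<subseteq> verts G \<times> verts G" "\<forall>v\<in>verts G. vertex_degree G v \<ge> 2" "y \<in> verts G"
  shows "nbrw_entropy n G x y \<ge> 0"
  using assms(3)
proof (induction n arbitrary: x y)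
  case (Suc n)
  then have "vertex_degree G y \<ge> 2"
    using assms(2) by auto
  moreover have "nbrw_entropy n G y z \<ge> 0" if "z \<in> adj G `` {y}" for z
    using Suc.IH that assms(1) by auto
  ultimately show ?case
    by (auto intro!: add_nonneg_nonneg sum_nonneg divide_nonneg_nonneg)
qed simp

text \<open>Summing over all \<open>x\<close> first, each \<open>z\<close> is counted \<open>deg y - 1\<close> times, which cancels the
  transition probability: the uniform measure on directed edges is stationary.\<close>

lemma sum_nbrw_entropy_Suc:
  assumes "finite (adj G `` {y})" "vertex_degree G y \<ge> 2"
  shows "(\<Sum>x\<in>adj G `` {y}. nbrw_entropy (Suc n) G x y) =
    real (vertex_degree G y) * ln (real (vertex_degree G y) - 1)
      + (\<Sum>z\<in>adj G `` {y}. nbrw_entropy n G y z)"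
proof -
  let ?N = "adj G `` {y}" and ?e = "nbrw_entropy n G y"
  have "(\<Sum>x\<in>?N. \<Sum>z\<in>?N - {x}. ?e z) = (\<Sum>x\<in>?N. (\<Sum>z\<in>?N. ?e z) - ?e x)"
    using assms(1) by (intro sum.cong) (auto simp: sum_diff1)
  also have "\<dots> = (real (vertex_degree G y) - 1) * (\<Sum>z\<in>?N. ?e z)"
    by (simp add: sum_subtractf vertex_degree_def algebra_simps)
  finally have "(\<Sum>x\<in>?N. \<Sum>z\<in>?N - {x}. ?e z) / (real (vertex_degree G y) - 1) = (\<Sum>z\<in>?N. ?e z)"
    using assms(2) by simp
  then show ?thesis
    by (simp add: sum.distrib sum_divide_distrib[symmetric] vertex_degree_def)
qed


section \<open>Mass transport\<close>

lemma doubly_rooted_eq_refl: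
  assumes "rooted_eq (G, x) (G, x)" "u \<in> verts G" "v \<in> verts G"
  shows "doubly_rooted_eq (G, u, v) (G, u, v)"
  using doubly_rooted_eqI[OF assms(1), of id u v] assms by simp

lemma nn_integral_neighbours:
  assumes "simple_graph G" "locally_finite G" "x \<in> verts G"
  shows "(\<integral>\<^sup>+v. (if (x, v) \<in> adj G then f v else 0) \<partial>count_space (verts G))
    = (\<Sum>v\<in>adj G `` {x}. f v)"
proof -
  have "finite (adj G `` {x})"
    using assms by (auto simp: locally_finite_def)
  moreover have "adj G `` {x} \<subseteq> verts G"
    using assms by (auto simp: simple_graph_def)
  ultimately have "(\<integral>\<^sup>+v. (if (x, v) \<in> adj G then f v else 0) \<partial>count_space (verts G)) =
      (\<Sum>v\<in>adj G `` {x}. if (x, v) \<in> adj G then f v else 0)"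
    by (intro nn_integral_count_space') auto
  then show ?thesis
    by simp
qed

lemma sum_from_root_edge_entropy:
  assumes "no_leaves g"
  shows "sum_from_root (edge_entropy n) g = ennreal (root_entropy n g)"
  using assms
proof (induction g rule: rooted_graph.abs_induct)
  case (1 A)
  obtain G x where [simp]: "A = (G, x)"
    by (metis surj_pair)
  have eq: "rooted_eq (G, x) (G, x)"
    using 1 by simp
  then have G: "simple_graph G" "locally_finite G" "x \<in> verts G"
    by (auto elim: rooted_eqE)
  have deg: "\<forall>v\<in>verts G. vertex_degree G v \<ge> 2"
    using 1 by (simp add: no_leaves.abs_eq)
  have "sum_from_root (edge_entropy n) (abs_rooted_graph (G, x)) =
      (\<integral>\<^sup>+v. (if (x, v) \<in> adj G then ennreal (nbrw_entropy n G x v) else 0) \<partial>count_space (verts G))"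
    using eq G(3) unfolding sum_from_root.abs_eq[OF eq] prod.case
    by (intro nn_integral_cong) (simp add: edge_entropy.abs_eq doubly_rooted_eq_refl)
  also have "\<dots> = (\<Sum>v\<in>adj G `` {x}. ennreal (nbrw_entropy n G x v))"
    by (rule nn_integral_neighbours[OF G])
  also have "\<dots> = ennreal (\<Sum>v\<in>adj G `` {x}. nbrw_entropy n G x v)"
    using G(1) deg by (intro sum_ennreal nbrw_entropy_nonneg) (auto simp: simple_graph_def)
  finally show ?case
    using eq by (simp add: root_entropy.abs_eq)
qed

text \<open>The mass received comes from walks that enter the root and make \<open>n + 1\<close>
  more steps. By stationarity the first of these contributes the degree term, and the remaining
  \<open>n\<close> contribute exactly the mass sent out by the root.\<close>

lemma sum_to_root_edge_entropy_Suc: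
  assumes "no_leaves g"
  shows "sum_to_root (edge_entropy (Suc n)) g =
    ennreal (real (root_degree g) * ln (real (root_degree g) - 1) + root_entropy n g)"
  using assms
proof (induction g rule: rooted_graph.abs_induct)
  case (1 A)
  obtain G x where [simp]: "A = (G, x)"
    by (metis surj_pair)
  have eq: "rooted_eq (G, x) (G, x)"
    using 1 by simp
  then have G: "simple_graph G" "locally_finite G" "x \<in> verts G"
    by (auto elim: rooted_eqE)
  have deg: "\<forall>v\<in>verts G. vertex_degree G v \<ge> 2"
    using 1 by (simp add: no_leaves.abs_eq)
  have sym: "(v, x) \<in> adj G \<longleftrightarrow> (x, v) \<in> adj G" for v
    using G(1) by (auto simp: simple_graph_def sym_def)
  have "sum_to_root (edge_entropy (Suc n)) (abs_rooted_graph (G, x)) =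
      (\<integral>\<^sup>+v. (if (x, v) \<in> adj G then ennreal (nbrw_entropy (Suc n) G v x) else 0)
        \<partial>count_space (verts G))"
    using eq G(3) unfolding sum_to_root.abs_eq[OF eq] prod.case
    by (intro nn_integral_cong)
      (simp add: edge_entropy.abs_eq doubly_rooted_eq_refl sym del: nbrw_entropy.simps)
  also have "\<dots> = (\<Sum>v\<in>adj G `` {x}. ennreal (nbrw_entropy (Suc n) G v x))"
    by (rule nn_integral_neighbours[OF G])
  also have "\<dots> = ennreal (\<Sum>v\<in>adj G `` {x}. nbrw_entropy (Suc n) G v x)"
    using G deg by (intro sum_ennreal nbrw_entropy_nonneg) (auto simp: simple_graph_def)
  also have "\<dots> = ennreal (real (vertex_degree G x) * ln (real (vertex_degree G x) - 1)
      + (\<Sum>z\<in>adj G `` {x}. nbrw_entropy n G x z))"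
    using G deg by (subst sum_nbrw_entropy_Suc) (auto simp: locally_finite_def)
  finally show ?case
    using eq by (simp add: root_entropy.abs_eq root_degree.abs_eq)
qed

section \<open>Expected entropy of the walk\<close>

lemma root_entropy_nonneg: "no_leaves g \<Longrightarrow> root_entropy n g \<ge> 0"
  by transfer (auto simp: rooted_eq_def marked_eq_def valid_marked_def simple_graph_def
      intro!: sum_nonneg nbrw_entropy_nonneg)

lemma root_entropy_0: "root_entropy 0 g = 0"
  by transfer auto

lemma root_degree_ge_2: "no_leaves g \<Longrightarrow> root_degree g \<ge> 2"
  by transfer (auto simp: rooted_eq_def marked_eq_def valid_marked_def)

text \<open>Unimodularity exchanges the mass sent for the mass received, which splits off one step
  of the walk; the induction repeats this. Both sides are allowed to be infinite.\<close>

lemma nn_integral_root_entropy: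
  assumes uni: "unimodular_network M X"
    and leaves: "AE \<omega> in M. no_leaves (X \<omega>)"
    and deg: "(\<lambda>\<omega>. real (root_degree (X \<omega>))) \<in> borel_measurable M"
  shows "(\<integral>\<^sup>+\<omega>. ennreal (root_entropy n (X \<omega>)) \<partial>M) =
    of_nat n * (\<integral>\<^sup>+\<omega>. ennreal (real (root_degree (X \<omega>)) * ln (real (root_degree (X \<omega>)) - 1)) \<partial>M)"
    (is "?E n = of_nat n * ?D")
proof (induction n)
  case 0
  then show ?case
    by (simp add: root_entropy_0)
next
  case (Suc n)
  have X: "X \<in> borel_measurable M"
    using uni by (auto simp: unimodular_network_def random_rooted_graph_def)
  have [measurable]: "(\<lambda>\<omega>. root_entropy n (X \<omega>)) \<in> borel_measurable M"
    by (rule measurable_compose[OF X borel_measurable_root_entropy])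
  note [measurable] = deg
  have "?E (Suc n) = (\<integral>\<^sup>+\<omega>. sum_from_root (edge_entropy (Suc n)) (X \<omega>) \<partial>M)"
    using leaves by (intro nn_integral_cong_AE) (auto simp: sum_from_root_edge_entropy)
  also have "\<dots> = (\<integral>\<^sup>+\<omega>. sum_to_root (edge_entropy (Suc n)) (X \<omega>) \<partial>M)"
    using uni borel_measurable_edge_entropy by (auto simp: unimodular_network_def)
  also have "\<dots> = (\<integral>\<^sup>+\<omega>. ennreal (real (root_degree (X \<omega>)) * ln (real (root_degree (X \<omega>)) - 1))
      + ennreal (root_entropy n (X \<omega>)) \<partial>M)"
  proof (rule nn_integral_cong_AE, use leaves in eventually_elim)
    fix \<omega> assume "no_leaves (X \<omega>)"
    then show "sum_to_root (edge_entropy (Suc n)) (X \<omega>) =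
        ennreal (real (root_degree (X \<omega>)) * ln (real (root_degree (X \<omega>)) - 1))
        + ennreal (root_entropy n (X \<omega>))"
      using root_degree_ge_2[of "X \<omega>"]
      by (simp add: sum_to_root_edge_entropy_Suc root_entropy_nonneg ennreal_plus)
  qed
  also have "\<dots> = ?D + ?E n"
    by (rule nn_integral_add) measurable
  finally show ?case
    using Suc.IH by (simp add: algebra_simps)
qed


section \<open>Counting non-backtracking walks\<close>

text \<open>The recursion runs parallel to that of \<open>nbrw_entropy\<close>, so that entropy and
  cardinality can be compared by one induction. Adjacency of \<open>x\<close> and \<open>y\<close>
  is imposed where the sets are used, as in \<open>NBW_Suc_eq\<close>.\<close>

primrec nbw_from_edge :: "nat \<Rightarrow> graph \<Rightarrow> nat \<Rightarrow> nat \<Rightarrow> nat list set" where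
  "nbw_from_edge 0 G x y = {[x, y]}"
| "nbw_from_edge (Suc n) G x y = (\<Union>z\<in>adj G `` {y} - {x}. (#) x ` nbw_from_edge n G y z)"

section \<open>Decomposition of walks by their first edge\<close>

lemma nbw_from_edge_nth:
  "w \<in> nbw_from_edge n G x y \<Longrightarrow> length w = n + 2 \<and> w ! 0 = x \<and> w ! 1 = y"
  by (induction n arbitrary: w x y) auto

lemma NBW_Suc_Suc:
  assumes "adj G \<subseteq> verts G \<times> verts G"
  shows "x # w \<in> NBW (Suc (Suc n)) G x \<longleftrightarrow>
    (x, w ! 0) \<in> adj G \<and> w ! 1 \<noteq> x \<and> w \<in> NBW (Suc n) G (w ! 0)"
proof -
  \<comment> \<open>Splitting off the index 1 isolates the one constraint that involves the new
    first vertex; the others are shifted constraints on \<open>w\<close>.\<close>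
  have iv: "(\<forall>i\<in>{1..Suc m}. P i) \<longleftrightarrow> P 1 \<and> (\<forall>i\<in>{1..m}. P (Suc i))" for m and P :: "nat \<Rightarrow> bool"
  proof -
    have "{1..Suc m} = insert 1 (Suc ` {1..m})"
      by (auto simp: image_Suc_atLeastAtMost)
    then show ?thesis
      by (simp only:) blast
  qed
  have 1: "(\<forall>i\<in>{1..Suc (Suc n)}. ((x # w) ! (i - 1), (x # w) ! i) \<in> adj G) \<longleftrightarrow>
      (x, w ! 0) \<in> adj G \<and> (\<forall>i\<in>{1..Suc n}. (w ! (i - 1), w ! i) \<in> adj G)"
    by (subst iv) (auto simp: nth_Cons')
  have 2: "(\<forall>i\<in>{1..Suc n}. (x # w) ! (i + 1) \<noteq> (x # w) ! (i - 1)) \<longleftrightarrow>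
      w ! 1 \<noteq> x \<and> (\<forall>i\<in>{1..n}. w ! (i + 1) \<noteq> w ! (i - 1))"
    by (subst iv) (auto simp: nth_Cons')
  have "(x, w ! 0) \<in> adj G \<Longrightarrow> x \<in> verts G"
    using assms by auto
  then show ?thesis
    unfolding NBW_def mem_Collect_eq using 1 2 by auto
qed

lemma NBW_Suc_eq:
  assumes "adj G \<subseteq> verts G \<times> verts G"
  shows "NBW (Suc n) G x = (\<Union>y\<in>adj G `` {x}. nbw_from_edge n G x y)"
proof (induction n arbitrary: x)
  case 0
  show ?case
    using assms by (auto simp: NBW_def length_Suc_conv)
next
  case (Suc n)
  have "w \<in> NBW (Suc (Suc n)) G x \<longleftrightarrow> w \<in> (\<Union>y\<in>adj G `` {x}. nbw_from_edge (Suc n) G x y)" for w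
  proof (cases "\<exists>v. w = x # v")
    case True
    then obtain v where w: "w = x # v"
      by blast
    have "w \<in> NBW (Suc (Suc n)) G x \<longleftrightarrow> (x, v ! 0) \<in> adj G \<and> v ! 1 \<noteq> x \<and>
        v \<in> (\<Union>z\<in>adj G `` {v ! 0}. nbw_from_edge n G (v ! 0) z)"
      unfolding w NBW_Suc_Suc[OF assms] Suc.IH ..
    \<comment> \<open>The witnesses are forced: a walk in \<open>nbw_from_edge n G y z\<close> has
      \<open>y\<close> and \<open>z\<close> as its first two entries.\<close>
    also have "\<dots> \<longleftrightarrow> (\<exists>y z. (x, y) \<in> adj G \<and> (y, z) \<in> adj G \<and> z \<noteq> x \<and> v \<in> nbw_from_edge n G y z)"
      using nbw_from_edge_nth[of v n G] by (simp add: Bex_def) metis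
    also have "\<dots> \<longleftrightarrow> w \<in> (\<Union>y\<in>adj G `` {x}. nbw_from_edge (Suc n) G x y)"
      by (auto simp: w)
    finally show ?thesis .
  next
    case False
    then show ?thesis
      by (auto simp: NBW_def length_Suc_conv)
  qed
  then show ?case
    by blast
qed

lemma finite_nbw_from_edge:
  assumes "\<And>v. finite (adj G `` {v})"
  shows "finite (nbw_from_edge n G x y)"
  using assms by (induction n arbitrary: x y) auto

text \<open>Walks for different \<open>z\<close> differ in their third vertex, so the union is
  disjoint.\<close>

lemma card_nbw_from_edge_Suc:
  assumes "\<And>v. finite (adj G `` {v})"
  shows "card (nbw_from_edge (Suc n) G x y) = (\<Sum>z\<in>adj G `` {y} - {x}. card (nbw_from_edge n G y z))"
proof -
  have "card (nbw_from_edge (Suc n) G x y)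
      = (\<Sum>z\<in>adj G `` {y} - {x}. card ((#) x ` nbw_from_edge n G y z))"
    unfolding nbw_from_edge.simps
    using assms finite_nbw_from_edge[OF assms]
    by (intro card_UN_disjoint) (auto dest!: nbw_from_edge_nth)
  then show ?thesis
    by (simp add: card_image)
qed

lemma card_NBW_Suc:
  assumes "adj G \<subseteq> verts G \<times> verts G" "\<And>v. finite (adj G `` {v})"
  shows "card (NBW (Suc n) G x) = (\<Sum>y\<in>adj G `` {x}. card (nbw_from_edge n G x y))"
  unfolding NBW_Suc_eq[OF assms(1)]
  using assms(2) finite_nbw_from_edge[OF assms(2)]
  by (intro card_UN_disjoint) (auto dest!: nbw_from_edge_nth)

text \<open>Jensen's inequality for \<open>exp\<close>, by the tangent at the mean \<open>m\<close>:
  the linear terms \<open>f i - m\<close> sum to zero.\<close>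

lemma exp_mean_le_sum_exp:
  fixes f :: "'a \<Rightarrow> real"
  assumes "finite S" "S \<noteq> {}"
  shows "real (card S) * exp ((\<Sum>i\<in>S. f i) / real (card S)) \<le> (\<Sum>i\<in>S. exp (f i))"
proof -
  define m where "m = (\<Sum>i\<in>S. f i) / real (card S)"
  have m: "(\<Sum>i\<in>S. f i) = real (card S) * m"
    using assms by (simp add: m_def card_0_eq)
  have "real (card S) * exp m = (\<Sum>i\<in>S. exp m * (1 + (f i - m)))"
    by (simp add: sum_distrib_left[symmetric] sum.distrib sum_subtractf m)
  also have "\<dots> \<le> (\<Sum>i\<in>S. exp m * exp (f i - m))"
    by (intro sum_mono mult_left_mono exp_ge_add_one_self) auto
  also have "\<dots> = (\<Sum>i\<in>S. exp (f i))"
    by (simp add: exp_diff)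
  finally show ?thesis
    by (simp add: m_def)
qed

text \<open>Entropy is at most the logarithm of the number of outcomes. In the induction, Jensen's
  inequality moves \<open>exp\<close> inside the average over the next vertex.\<close>

lemma exp_nbrw_entropy_le:
  assumes G: "adj G \<subseteq> verts G \<times> verts G" "\<And>v. finite (adj G `` {v})" "sym (adj G)"
    and deg: "\<forall>v\<in>verts G. vertex_degree G v \<ge> 2" and "(x, y) \<in> adj G"
  shows "exp (nbrw_entropy n G x y) \<le> real (card (nbw_from_edge n G x y))"
  using assms(5)
proof (induction n arbitrary: x y)
  case (Suc n)
  let ?S = "adj G `` {y} - {x}"
  have "x \<in> adj G `` {y}"
    using Suc.prems G(3) by (auto simp: sym_def)
  moreover have d: "vertex_degree G y \<ge> 2"
    using Suc.prems G(1) deg by auto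
  \<comment> \<open>Since \<open>x\<close> is itself a neighbour of \<open>y\<close>, removing it
    leaves \<open>deg y - 1\<close> continuations; without leaves there is at least one.\<close>
  ultimately have S: "real (card ?S) = real (vertex_degree G y) - 1"
    using G(2) by (simp add: vertex_degree_def card_Diff_singleton of_nat_diff)
  with d have pos: "real (card ?S) > 0"
    by simp
  have "exp (nbrw_entropy (Suc n) G x y)
      = real (card ?S) * exp ((\<Sum>z\<in>?S. nbrw_entropy n G y z) / real (card ?S))"
    using pos by (simp add: S exp_add)
  also have "\<dots> \<le> (\<Sum>z\<in>?S. exp (nbrw_entropy n G y z))"
    using pos G(2) by (intro exp_mean_le_sum_exp) (auto simp: card_gt_0_iff)
  also have "\<dots> \<le> (\<Sum>z\<in>?S. real (card (nbw_from_edge n G y z)))"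
    by (intro sum_mono Suc.IH) auto
  finally show ?case
    by (simp only: card_nbw_from_edge_Suc[OF G(2)] of_nat_sum)
qed simp

text \<open>The tangent of \<open>exp\<close> at \<open>n * ln a\<close>; the choice of \<open>a\<close> is left free here and becomes the
  expected degree minus one.\<close>

lemma NBW_count_Suc_ge:
  assumes "no_leaves g" "a > 0"
  shows "a ^ n * (real (root_degree g) + root_entropy n g - real n * ln a * real (root_degree g))
    \<le> real (NBW_count (Suc n) g)"
  using assms
proof (induction g rule: rooted_graph.abs_induct)
  case (1 A)
  obtain G x where [simp]: "A = (G, x)"
    by (metis surj_pair)
  have eq: "rooted_eq (G, x) (G, x)"
    using 1 by simp
  then have G: "simple_graph G" "locally_finite G" "x \<in> verts G"
    by (auto elim: rooted_eqE)
  then have sub: "adj G \<subseteq> verts G \<times> verts G" and sym: "sym (adj G)"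
    by (auto simp: simple_graph_def)
  have fin: "finite (adj G `` {v})" for v
  proof (cases "v \<in> verts G")
    case False
    then have "adj G `` {v} = {}"
      using sub by auto
    then show ?thesis
      by simp
  qed (use G(2) in \<open>auto simp: locally_finite_def\<close>)
  have deg: "\<forall>v\<in>verts G. vertex_degree G v \<ge> 2"
    using 1 by (simp add: no_leaves.abs_eq)
  let ?N = "adj G `` {x}" and ?e = "nbrw_entropy n G x"
  have "a ^ n * (real (card ?N) + (\<Sum>y\<in>?N. ?e y) - real n * ln a * real (card ?N))
      = (\<Sum>y\<in>?N. a ^ n * (1 + (?e y - real n * ln a)))"
    by (simp add: sum_distrib_left[symmetric] sum.distrib sum_subtractf algebra_simps)
  also have "\<dots> \<le> (\<Sum>y\<in>?N. a ^ n * exp (?e y - real n * ln a))"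
    using \<open>a > 0\<close> by (intro sum_mono mult_left_mono exp_ge_add_one_self) auto
  \<comment> \<open>The factor \<open>a ^ n\<close> equals \<open>exp (n * ln a)\<close> and cancels
    the shift in the exponent.\<close>
  also have "\<dots> = (\<Sum>y\<in>?N. exp (?e y))"
    using \<open>a > 0\<close> by (simp add: exp_diff exp_of_nat_mult)
  also have "\<dots> \<le> (\<Sum>y\<in>?N. real (card (nbw_from_edge n G x y)))"
    by (intro sum_mono exp_nbrw_entropy_le sub fin sym deg) auto
  also have "\<dots> = real (card (NBW (Suc n) G x))"
    by (simp only: card_NBW_Suc[OF sub fin] of_nat_sum)
  finally show ?case
    using eq by (simp add: root_entropy.abs_eq root_degree.abs_eq NBW_count.abs_eq vertex_degree_def)
qed


section \<open>The lower bound\<close>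

text \<open>Convexity of \<open>x * ln (x - 1)\<close>: its second derivative
  \<open>(x - 2) / (x - 1)^2\<close> is nonnegative from 2 on. The tangent at \<open>d\<close> is
  arranged so that its last term averages to zero when \<open>k\<close> has mean
  \<open>d\<close>.\<close>

lemma xlnx_tangent:
  fixes d k :: real
  assumes "d \<ge> 2" "k \<ge> 2"
  shows "k * ln (k - 1) \<ge> k * ln (d - 1) + (k - d) * (d / (d - 1))"
proof -
  define f where "f = (\<lambda>x::real. x * ln (x - 1))"
  define f' where "f' = (\<lambda>x::real. ln (x - 1) + x / (x - 1))"
  have "f' d * (k - d) \<le> f k - f d"
  proof (rule f''_imp_f'[of "{2..}"])
    fix x :: real assume x: "x \<in> {2..}"
    show "(f has_real_derivative f' x) (at x)"
      unfolding f_def f'_def using x by (auto intro!: derivative_eq_intros)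
    show "(f' has_real_derivative ((x - 2) / (x - 1)\<^sup>2)) (at x)"
    proof -
      have "1 / (x - 1) + (x - 1 - x) / (x - 1)\<^sup>2 = (x - 2) / (x - 1)\<^sup>2"
        using x by (simp add: divide_simps power2_eq_square)
      then show ?thesis
        unfolding f'_def using x by (auto intro!: derivative_eq_intros simp: power2_eq_square)
    qed
    show "(x - 2) / (x - 1)\<^sup>2 \<ge> 0"
      using x by auto
  qed (use assms in auto)
  then show ?thesis
    by (simp add: f_def f'_def algebra_simps)
qed

text \<open>The cast to \<open>ennreal\<close> truncates negative values to 0, so the right side
  integrates the positive part of \<open>f\<close>.\<close>

lemma ennreal_integral_le_nn_integral:
  fixes f :: "'a \<Rightarrow> real"
  assumes "integrable M f"
  shows "ennreal (integral\<^sup>L M f) \<le> (\<integral>\<^sup>+x. ennreal (f x) \<partial>M)"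
proof -
  have "integral\<^sup>L M f \<le> (LINT x|M. max 0 (f x))"
    using assms by (intro integral_mono) auto
  then have "ennreal (integral\<^sup>L M f) \<le> ennreal (LINT x|M. max 0 (f x))"
    by (rule ennreal_leI)
  also have "\<dots> = (\<integral>\<^sup>+x. ennreal (max 0 (f x)) \<partial>M)"
    using assms by (intro nn_integral_eq_integral[symmetric]) auto
  also have "\<dots> = (\<integral>\<^sup>+x. ennreal (f x) \<partial>M)"
    by (intro nn_integral_cong) (auto simp: max_def ennreal_neg)
  finally show ?thesis .
qed

theorem mainTheorem5:
  fixes M :: "'w measure" and X :: "'w \<Rightarrow> rooted_graph" and r :: nat
  assumes "unimodular_network M X"
    and "AE \<omega> in M. no_leaves (X \<omega>)"
    and "integrable M (\<lambda>\<omega>. real (root_degree (X \<omega>)))"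
    and "r \<ge> 1"
  shows "(\<integral>\<^sup>+\<omega>. of_nat (NBW_count r (X \<omega>)) \<partial>M) \<ge>
    ennreal ((LINT \<omega>|M. real (root_degree (X \<omega>)))
      * ((LINT \<omega>|M. real (root_degree (X \<omega>))) - 1) ^ (r - 1))"
proof -
  let ?deg = "\<lambda>\<omega>. real (root_degree (X \<omega>))"
  define d where "d = (LINT \<omega>|M. ?deg \<omega>)"
  define c where "c = ln (d - 1)"
  obtain n where r: "r = Suc n"
    using assms(4) by (cases r) auto
  let ?H = "\<lambda>\<omega>. root_entropy n (X \<omega>)"
  \<comment> \<open>The lower bound of \<open>NBW_count_Suc_ge\<close> with
    \<open>a = d - 1\<close>; its value can be negative.\<close>
  let ?h = "\<lambda>\<omega>. (d - 1) ^ n * (?deg \<omega> + ?H \<omega> - real n * c * ?deg \<omega>)"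
  have X: "X \<in> borel_measurable M" and "prob_space M"
    using assms(1) by (auto simp: unimodular_network_def random_rooted_graph_def)
  interpret prob_space M by fact
  note [measurable] = borel_measurable_integrable[OF assms(3)]
  have [measurable]: "?H \<in> borel_measurable M"
    by (rule measurable_compose[OF X borel_measurable_root_entropy])
  have deg2: "AE \<omega> in M. ?deg \<omega> \<ge> 2"
    using assms(2) by eventually_elim (use root_degree_ge_2 in force)
  have "(LINT \<omega>|M. 2) \<le> d"
    unfolding d_def using deg2 assms(3) by (intro integral_mono_AE) auto
  then have d: "d \<ge> 2"
    by (simp add: prob_space)
  then have c: "c \<ge> 0"
    by (simp add: c_def)
  \<comment> \<open>The added term has mean zero and completes \<open>?deg \<omega> * c\<close> to
    the tangent of \<open>x * ln (x - 1)\<close> at \<open>d\<close>.\<close>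
  have "ennreal (d * c) = ennreal (LINT \<omega>|M. ?deg \<omega> * c + (?deg \<omega> - d) * (d / (d - 1)))"
    using assms(3) by (simp add: d_def[symmetric] prob_space)
  also have "\<dots> \<le> (\<integral>\<^sup>+\<omega>. ennreal (?deg \<omega> * c + (?deg \<omega> - d) * (d / (d - 1))) \<partial>M)"
    using assms(3) by (intro ennreal_integral_le_nn_integral) auto
  also have "\<dots> \<le> (\<integral>\<^sup>+\<omega>. ennreal (?deg \<omega> * ln (?deg \<omega> - 1)) \<partial>M)"
  proof (rule nn_integral_mono_AE, use deg2 in eventually_elim)
    fix \<omega> assume "?deg \<omega> \<ge> 2"
    with xlnx_tangent[OF d this]
    show "ennreal (?deg \<omega> * c + (?deg \<omega> - d) * (d / (d - 1))) \<le> ennreal (?deg \<omega> * ln (?deg \<omega> - 1))"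
      by (intro ennreal_leI) (simp add: c_def)
  qed
  finally have "ennreal (real n) * ennreal (d * c) \<le> (\<integral>\<^sup>+\<omega>. ennreal (?H \<omega>) \<partial>M)"
    unfolding nn_integral_root_entropy[OF assms(1,2) borel_measurable_integrable[OF assms(3)]]
    by (simp add: ennreal_of_nat_eq_real_of_nat mult_left_mono)
  then have H: "ennreal (real n * (d * c)) \<le> (\<integral>\<^sup>+\<omega>. ennreal (?H \<omega>) \<partial>M)"
    using d c by (simp add: ennreal_mult)
  have E: "(\<integral>\<^sup>+\<omega>. ennreal (?deg \<omega>) \<partial>M) = ennreal d"
    unfolding d_def using assms(3) by (intro nn_integral_eq_integral) auto
  \<comment> \<open>The coefficient of the degree subtracted in \<open>?h\<close>. Adding
    \<open>K * ?deg \<omega>\<close> to both sides avoids subtraction of possibly infinite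
    integrals.\<close>
  define K where "K = (d - 1) ^ n * (real n * c)"
  have K: "K \<ge> 0"
    using d c by (simp add: K_def)
  have "ennreal (d * (d - 1) ^ n) + ennreal (K * d)
      = ennreal ((d - 1) ^ n) * (ennreal d + ennreal (real n * (d * c)))"
    using d c K by (simp add: K_def ennreal_plus[symmetric] ennreal_mult[symmetric] algebra_simps
        del: ennreal_plus)
  also have "\<dots> \<le> ennreal ((d - 1) ^ n) * ((\<integral>\<^sup>+\<omega>. ennreal (?deg \<omega>) \<partial>M) + (\<integral>\<^sup>+\<omega>. ennreal (?H \<omega>) \<partial>M))"
    unfolding E by (intro mult_left_mono add_left_mono H) auto
  also have "\<dots> = (\<integral>\<^sup>+\<omega>. ennreal ((d - 1) ^ n) * (ennreal (?deg \<omega>) + ennreal (?H \<omega>)) \<partial>M)"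
    by (subst nn_integral_cmult) (auto simp: nn_integral_add)
  also have "\<dots> \<le> (\<integral>\<^sup>+\<omega>. ennreal (?h \<omega>) + ennreal (K * ?deg \<omega>) \<partial>M)"
  proof (rule nn_integral_mono_AE, use assms(2) in eventually_elim)
    fix \<omega> assume "no_leaves (X \<omega>)"
    then have "?H \<omega> \<ge> 0"
      by (rule root_entropy_nonneg)
    then have "ennreal ((d - 1) ^ n) * (ennreal (?deg \<omega>) + ennreal (?H \<omega>))
        = ennreal (?h \<omega> + K * ?deg \<omega>)"
      using d by (simp add: K_def ennreal_plus[symmetric] ennreal_mult[symmetric] algebra_simps
        del: ennreal_plus)
    \<comment> \<open>Where \<open>?h \<omega>\<close> is negative, its cast is 0, which only
      enlarges the right side.\<close>
    also have "\<dots> \<le> ennreal (?h \<omega>) + ennreal (K * ?deg \<omega>)"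
      by (auto simp: ennreal_plus_if intro!: ennreal_leI)
    finally show "ennreal ((d - 1) ^ n) * (ennreal (?deg \<omega>) + ennreal (?H \<omega>))
        \<le> ennreal (?h \<omega>) + ennreal (K * ?deg \<omega>)" .
  qed
  also have "\<dots> = (\<integral>\<^sup>+\<omega>. ennreal (?h \<omega>) \<partial>M) + (\<integral>\<^sup>+\<omega>. ennreal (K * ?deg \<omega>) \<partial>M)"
    by (rule nn_integral_add) measurable
  also have "(\<integral>\<^sup>+\<omega>. ennreal (K * ?deg \<omega>) \<partial>M) = ennreal (K * d)"
    using K d E by (simp add: ennreal_mult nn_integral_cmult)
  \<comment> \<open>The expected degree is finite, so \<open>ennreal (K * d)\<close> is finite and
    cancels, even if the expected entropy is infinite.\<close>
  finally have "ennreal (d * (d - 1) ^ n) \<le> (\<integral>\<^sup>+\<omega>. ennreal (?h \<omega>) \<partial>M)"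
    by (simp add: add.commute[of _ "ennreal (K * d)"] ennreal_add_left_cancel_le)
  also have "\<dots> \<le> (\<integral>\<^sup>+\<omega>. of_nat (NBW_count r (X \<omega>)) \<partial>M)"
  proof (rule nn_integral_mono_AE, use assms(2) in eventually_elim)
    fix \<omega> assume "no_leaves (X \<omega>)"
    with NBW_count_Suc_ge[of "X \<omega>" "d - 1" n] d
    show "ennreal (?h \<omega>) \<le> of_nat (NBW_count r (X \<omega>))"
      by (simp add: r c_def ennreal_of_nat_eq_real_of_nat ennreal_leI)
  qed
  finally show ?thesis
    by (simp add: r d_def)
qed

end
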